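(* Let $\sigma>0$, let $(\mathcal M,g)$ be an admissible Riemannian manifold and let $\mathcal W$ be admissible. Let $I>2$, $0\le t_1<\ldots<t_I\le1$, $\bar y_1,\ldots,\bar y_I\in\mathcal M$, let $K\in\mathbb N$ be such that $Kt_i\in\mathbb N_0$ for all $i$, and choose one of the discrete natural, Hermite, or periodic boundary conditions. Then there exists a discrete spline interpolation $y^K=(y_0,\ldots,y_K)\in\mathcal M^{K+1}$, i.e. a minimizer of the discrete regularized spline energy $\mathbf F^{\sigma,K}$ among all $(K+1)$-tuples in $\mathcal M^{K+1}$ which satisfy the interpolation constraints $y_{Kt_i}=\bar y_i$, $i=1,\ldots,I$, and the chosen discrete boundary condition.
   Context: **Admissible manifold and metric.** $\mathbf V$ is a separable real Hilbert space compactly embedded in a real Banach space $\mathbf Y$ (the identity $\mathbf V\to\mathbf Y$ is a compact linear operator); $\mathcal M=\mathbf V$ is the admissible manifold, with $T_y\mathcal M=\mathbf V$. A Riemannian metric $g$ on $\mathcal M$ is admissible if it extends to a function $g:\mathbf Y\times\mathbf V\times\mathbf V\to\mathbb R$ of the form $g_y(v,w)=g^c_y(v,w)+\mathcal Q(v,w)$ such that, for all $y\in\mathbf Y$, $v\in\mathbf V$: (i) $g^c$ is symmetric (bilinear) in the last two arguments and $g^c_y(v,v)\le C^\ast\|v\|_{\mathbf Y}^2$ for some constant $C^\ast$; (ii) $g^c$ is twice differentiable with bounded derivatives as a function $g^c:\mathbf Y\to\mathbf Y'\otimes\mathbf Y'$ (primes denote duals; the tensor product carries the topology of the injective cross norm);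 (iii) $\mathcal Q$ is symmetric, positive semi-definite and bilinear on $\mathbf V\times\mathbf V$ with $\mathcal Q(v,v)\le C^{\ast\ast}\|v\|_{\mathbf V}^2$ for some constant $C^{\ast\ast}$; (iv) $c^\ast\|v\|_{\mathbf V}^2\le g_y(v,v)$ for some $c^\ast>0$. **Admissible $\mathcal W$.** Let $\mathrm{dist}$ be the Riemannian distance on $(\mathcal M,g)$. $\mathcal W:\mathbf V\times\mathbf V\to[0,\infty]$ is admissible if $\mathcal W[y,\tilde y]=\mathcal W^c[y,\tilde y]+\mathcal Q(y-\tilde y,y-\tilde y)$ with $\mathcal Q$ the quadratic part in the decomposition $g_y(v,w)=g^c_y(v,w)+\mathcal Q(v,w)$ of the admissible metric $g$ and some $\mathcal W^c:\mathbf V\times\mathbf V\to[0,\infty]$ such that (i) there exist $\varepsilon,C>0$ with $|\mathcal W[y,\tilde y]-\mathrm{dist}^2(y,\tilde y)|\le C\,\mathrm{dist}^3(y,\tilde y)$ for all $y,\tilde y\in\mathcal M$ with $\mathrm{dist}(y,\tilde y)\le\varepsilon$; (ii) $\mathcal W^c$ is four times continuously differentiable on $\mathbf V\times\mathbf V$; (iii) $\mathcal W^c$ is continuous under weak convergence in $\mathbf V\times\mathbf V$; (iv) $\mathcal W[y,\tilde y]\ge\gamma(\|y-\tilde y\|_{\mathbf V})$ for a strictly increasing, continuous $\gamma$ with $\gamma(0)=0$ and $\lim_{d\to\infty}\gamma(d)=\infty$. **Discrete energies.** For $(y_0,\ldots,y_K)\in\mathcal M^{K+1}$, $\mathbf E^K[y_0,\ldots,y_K]=K\sum_{k=1}^K\mathcal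 W[y_{k-1},y_k]$, $\mathbf F^K[y_0,\ldots,y_K]=4K^3\sum_{k=1}^{\widehat K}\mathcal W[y_k,\tilde y_k]$ with $\tilde y_k\in\operatorname{argmin}_{y\in\mathcal M}\big(\mathcal W[y_{k-1},y]+\mathcal W[y,y_{k+1}]\big)$, $\mathbf F^{\sigma,K}=\mathbf F^K+\sigma\mathbf E^K$. Here $\widehat K=K-1$ for natural and Hermite boundary conditions, while for periodic boundary conditions $\widehat K=K$ and $y_{K+1}\equiv y_1$. **Discrete boundary conditions.** Natural: no additional condition. Hermite: $K(y_1-y_0)=v_0$ and $K(y_K-y_{K-1})=v_1$ for given $v_0,v_1\in\mathbf V$; in this case $t_1=0$ and $t_I=1$. Periodic: $y_0=y_K$; in this case $t_1\ne0$ or $t_I\ne1$.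
   Formalization: For Hermite boundary conditions it is additionally assumed that some tuple satisfies both the interpolation constraints and the boundary condition; otherwise (e.g. I=3, K=2, t=(0,1/2,1), with ȳ_2 ≠ ȳ_1+v_0/2) no competitor exists. *)

theory Defs
  imports "HOL-Analysis.Analysis"
begin

definition compact_embedding :: "('v::real_normed_vector \<Rightarrow> 'y::real_normed_vector) \<Rightarrow> bool" where
  "compact_embedding \<iota> \<longleftrightarrow> linear \<iota> \<and> inj \<iota> \<and> (\<forall>S. bounded S \<longrightarrow> compact (closure (\<iota> ` S)))"

(* Y' (x) Y' with the injective cross norm (completed). An element of the algebraic tensor product is
   a finite sum of elementary tensors (v, w) |-> \<phi> v * \<psi> w, and its injective norm is its norm as a
   bounded bilinear form on Y x Y, since the unit ball of Y is weak-* dense in that of Y''. Hence the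
   completion is the closure of the elementary tensors' span among the bounded bilinear forms. *)
definition injective_tensor_dual :: "('y::real_normed_vector \<Rightarrow>\<^sub>L 'y \<Rightarrow>\<^sub>L real) set" where
  "injective_tensor_dual =
     closure (span {B :: 'y \<Rightarrow>\<^sub>L 'y \<Rightarrow>\<^sub>L real. \<exists>\<phi> \<psi> :: 'y \<Rightarrow>\<^sub>L real. \<forall>v w. B v w = \<phi> v * \<psi> w})"

definition twice_differentiable_bounded ::
    "('a::real_normed_vector \<Rightarrow> 'b::real_normed_vector) \<Rightarrow> bool" where
  "twice_differentiable_bounded f \<longleftrightarrow>
     (\<exists>(D1 :: 'a \<Rightarrow> 'a \<Rightarrow>\<^sub>L 'b) (D2 :: 'a \<Rightarrow> 'a \<Rightarrow>\<^sub>L 'a \<Rightarrow>\<^sub>L 'b).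
        (\<forall>x. (f has_derivative blinfun_apply (D1 x)) (at x)) \<and> (\<forall>x. (D1 has_derivative blinfun_apply (D2 x)) (at x)) \<and>
        bounded (range D1) \<and> bounded (range D2))"

definition C4 :: "('a::real_normed_vector \<Rightarrow> 'b::real_normed_vector) \<Rightarrow> bool" where
  "C4 f \<longleftrightarrow>
     (\<exists>(D1 :: 'a \<Rightarrow> 'a \<Rightarrow>\<^sub>L 'b) (D2 :: 'a \<Rightarrow> 'a \<Rightarrow>\<^sub>L 'a \<Rightarrow>\<^sub>L 'b)
       (D3 :: 'a \<Rightarrow> 'a \<Rightarrow>\<^sub>L 'a \<Rightarrow>\<^sub>L 'a \<Rightarrow>\<^sub>L 'b)
       (D4 :: 'a \<Rightarrow> 'a \<Rightarrow>\<^sub>L 'a \<Rightarrow>\<^sub>L 'a \<Rightarrow>\<^sub>L 'a \<Rightarrow>\<^sub>L 'b).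
        (\<forall>x. (f has_derivative blinfun_apply (D1 x)) (at x)) \<and> (\<forall>x. (D1 has_derivative blinfun_apply (D2 x)) (at x)) \<and>
        (\<forall>x. (D2 has_derivative blinfun_apply (D3 x)) (at x)) \<and> (\<forall>x. (D3 has_derivative blinfun_apply (D4 x)) (at x)) \<and>
        continuous_on UNIV D4)"

(* The metric g lives on the manifold V. The embedding \<iota> identifies V with a subset of Y, and
   \<lambda>y v w. gc y (\<iota> v) (\<iota> w) + Q v w is the extension of g to Y x V x V. *)
definition admissible_metric ::
    "('v::real_inner \<Rightarrow> 'y::real_normed_vector) \<Rightarrow> ('v \<Rightarrow> 'v \<Rightarrow> 'v \<Rightarrow> real) \<Rightarrow>
     ('y \<Rightarrow> 'y \<Rightarrow>\<^sub>L 'y \<Rightarrow>\<^sub>L real) \<Rightarrow> ('v \<Rightarrow> 'v \<Rightarrow> real) \<Rightarrow> bool" where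
  "admissible_metric \<iota> g gc Q \<longleftrightarrow>
     (\<forall>y v w. g y v w = gc (\<iota> y) (\<iota> v) (\<iota> w) + Q v w) \<and>
     (\<forall>y v w. gc y (\<iota> v) (\<iota> w) = gc y (\<iota> w) (\<iota> v)) \<and>
     (\<exists>C. \<forall>y v. gc y (\<iota> v) (\<iota> v) \<le> C * (norm (\<iota> v))\<^sup>2) \<and>
     range gc \<subseteq> injective_tensor_dual \<and> twice_differentiable_bounded gc \<and>
     bilinear Q \<and> (\<forall>v w. Q v w = Q w v) \<and> (\<forall>v. 0 \<le> Q v v) \<and>
     (\<exists>C. \<forall>v. Q v v \<le> C * (norm v)\<^sup>2) \<and>
     (\<exists>c>0. \<forall>y v. c * (norm v)\<^sup>2 \<le> gc y (\<iota> v) (\<iota> v) + Q v v)"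

definition curve_length ::
    "('v::real_normed_vector \<Rightarrow> 'v \<Rightarrow> 'v \<Rightarrow> real) \<Rightarrow> (real \<Rightarrow> 'v) \<Rightarrow> real" where
  "curve_length g c =
     integral {0..1} (\<lambda>t. sqrt (g (c t) (vector_derivative c (at t)) (vector_derivative c (at t))))"

(* The library's piecewise_C1_differentiable_on allows unbounded derivatives at the break points,
   hence curves of infinite length, to which integral would assign length 0. Genuine C1 curves avoid
   this and give the same infimum as the classical piecewise C1 curves. *)
definition riemannian_dist ::
    "('v::real_normed_vector \<Rightarrow> 'v \<Rightarrow> 'v \<Rightarrow> real) \<Rightarrow> 'v \<Rightarrow> 'v \<Rightarrow> real" where
  "riemannian_dist g x y =
     Inf {curve_length g c | c. c C1_differentiable_on {0..1} \<and> c 0 = x \<and> c 1 = y}"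

definition weakly_converges :: "(nat \<Rightarrow> 'v::real_inner) \<Rightarrow> 'v \<Rightarrow> bool" where
  "weakly_converges x l \<longleftrightarrow> (\<forall>w. (\<lambda>n. inner (x n) w) \<longlonglongrightarrow> inner l w)"

(* The values lie in [0,\<infinity>]; four-fold differentiability on all of V x V includes finiteness of Wc
   (and hence of W), so enn2real loses nothing in admissible_W. *)
definition admissible_W ::
    "('v::real_inner \<Rightarrow> 'v \<Rightarrow> 'v \<Rightarrow> real) \<Rightarrow> ('v \<Rightarrow> 'v \<Rightarrow> real) \<Rightarrow> ('v \<Rightarrow> 'v \<Rightarrow> ennreal) \<Rightarrow> bool" where
  "admissible_W g Q W \<longleftrightarrow>
     (\<exists>Wc :: 'v \<Rightarrow> 'v \<Rightarrow> ennreal.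
        (\<forall>y z. W y z = Wc y z + ennreal (Q (y - z) (y - z))) \<and>
        (\<exists>\<epsilon>>0. \<exists>C>0. \<forall>y z. riemannian_dist g y z \<le> \<epsilon> \<longrightarrow>
           \<bar>enn2real (W y z) - (riemannian_dist g y z)\<^sup>2\<bar> \<le> C * (riemannian_dist g y z) ^ 3) \<and>
        (\<forall>y z. Wc y z < \<infinity>) \<and> C4 (\<lambda>p. enn2real (Wc (fst p) (snd p))) \<and>
        (\<forall>y z y' z'. weakly_converges y y' \<and> weakly_converges z z' \<longrightarrow>
           (\<lambda>n. Wc (y n) (z n)) \<longlonglongrightarrow> Wc y' z') \<and>
        (\<exists>\<gamma> :: real \<Rightarrow> real. strict_mono_on {0..} \<gamma> \<and> continuous_on {0..} \<gamma> \<and> \<gamma> 0 = 0 \<and>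
           filterlim \<gamma> at_top at_top \<and> (\<forall>y z. ennreal (\<gamma> (norm (y - z))) \<le> W y z)))"

datatype 'v boundary_condition = Natural | Hermite 'v 'v | Periodic

fun times_compatible :: "'v boundary_condition \<Rightarrow> real \<Rightarrow> real \<Rightarrow> bool" where
  "times_compatible Natural t1 tI \<longleftrightarrow> True"
| "times_compatible (Hermite v0 v1) t1 tI \<longleftrightarrow> t1 = 0 \<and> tI = 1"
| "times_compatible Periodic t1 tI \<longleftrightarrow> t1 \<noteq> 0 \<or> tI \<noteq> 1"

(* Tuples (y 0, ..., y K) are represented by functions on nat; only the values at 0..K are used. *)
fun satisfies_bc :: "'v::real_vector boundary_condition \<Rightarrow> nat \<Rightarrow> (nat \<Rightarrow> 'v) \<Rightarrow> bool" where
  "satisfies_bc Natural K y \<longleftrightarrow> True"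
| "satisfies_bc (Hermite v0 v1) K y \<longleftrightarrow>
     real K *\<^sub>R (y 1 - y 0) = v0 \<and> real K *\<^sub>R (y K - y (K - 1)) = v1"
| "satisfies_bc Periodic K y \<longleftrightarrow> y 0 = y K"

definition interpolates ::
    "nat \<Rightarrow> nat \<Rightarrow> (nat \<Rightarrow> real) \<Rightarrow> (nat \<Rightarrow> 'v) \<Rightarrow> (nat \<Rightarrow> 'v) \<Rightarrow> bool" where
  "interpolates K I t ybar y \<longleftrightarrow> (\<forall>i\<in>{1..I}. y (nat \<lfloor>real K * t i\<rfloor>) = ybar i)"

definition feasible ::
    "'v::real_vector boundary_condition \<Rightarrow> nat \<Rightarrow> nat \<Rightarrow> (nat \<Rightarrow> real) \<Rightarrow> (nat \<Rightarrow> 'v) \<Rightarrow>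
     (nat \<Rightarrow> 'v) \<Rightarrow> bool" where
  "feasible bc K I t ybar y \<longleftrightarrow> interpolates K I t ybar y \<and> satisfies_bc bc K y"

definition K_hat :: "'v boundary_condition \<Rightarrow> nat \<Rightarrow> nat" where
  "K_hat bc K = (if bc = Periodic then K else K - 1)"

(* y_{k+1}, with the convention y_{K+1} = y_1 in the periodic case *)
definition successor :: "'v boundary_condition \<Rightarrow> nat \<Rightarrow> (nat \<Rightarrow> 'v) \<Rightarrow> nat \<Rightarrow> 'v" where
  "successor bc K y k = (if bc = Periodic \<and> k = K then y 1 else y (k + 1))"

(* yt k is one of the possibly several choices of the minimizer called y_k with a tilde *)
definition midpoints ::
    "('v \<Rightarrow> 'v \<Rightarrow> ennreal) \<Rightarrow> 'v boundary_condition \<Rightarrow> nat \<Rightarrow> (nat \<Rightarrow> 'v) \<Rightarrow> (nat \<Rightarrow> 'v) \<Rightarrow> bool" where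
  "midpoints W bc K y yt \<longleftrightarrow>
     (\<forall>k\<in>{1..K_hat bc K}.
        is_arg_min (\<lambda>z. W (y (k - 1)) z + W z (successor bc K y k)) (\<lambda>_. True) (yt k))"

definition E_energy :: "('v \<Rightarrow> 'v \<Rightarrow> ennreal) \<Rightarrow> nat \<Rightarrow> (nat \<Rightarrow> 'v) \<Rightarrow> ennreal" where
  "E_energy W K y = of_nat K * (\<Sum>k=1..K. W (y (k - 1)) (y k))"

definition F_energy ::
    "('v \<Rightarrow> 'v \<Rightarrow> ennreal) \<Rightarrow> 'v boundary_condition \<Rightarrow> nat \<Rightarrow> (nat \<Rightarrow> 'v) \<Rightarrow> (nat \<Rightarrow> 'v) \<Rightarrow> ennreal" where
  "F_energy W bc K y yt = 4 * of_nat K ^ 3 * (\<Sum>k=1..K_hat bc K. W (y k) (yt k))"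

definition regularized_energy ::
    "real \<Rightarrow> ('v \<Rightarrow> 'v \<Rightarrow> ennreal) \<Rightarrow> 'v boundary_condition \<Rightarrow> nat \<Rightarrow> (nat \<Rightarrow> 'v) \<Rightarrow> (nat \<Rightarrow> 'v) \<Rightarrow> ennreal"
  where
  "regularized_energy \<sigma> W bc K y yt = F_energy W bc K y yt + ennreal \<sigma> * E_energy W K y"

(* If the midpoints are not unique, the energy of y depends on their choice. It is understood as the
   least value over all choices: y is a minimizer if, for some choice of its midpoints, its energy is
   at most that of any feasible tuple with any choice of midpoints. *)
definition discrete_spline_interpolation ::
    "real \<Rightarrow> ('v::real_vector \<Rightarrow> 'v \<Rightarrow> ennreal) \<Rightarrow> 'v boundary_condition \<Rightarrow> nat \<Rightarrow> nat \<Rightarrow>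
     (nat \<Rightarrow> real) \<Rightarrow> (nat \<Rightarrow> 'v) \<Rightarrow> (nat \<Rightarrow> 'v) \<Rightarrow> bool" where
  "discrete_spline_interpolation \<sigma> W bc K I t ybar y \<longleftrightarrow>
     (\<exists>yt. is_arg_min (\<lambda>(y, yt). regularized_energy \<sigma> W bc K y yt)
             (\<lambda>(y, yt). feasible bc K I t ybar y \<and> midpoints W bc K y yt) (y, yt))"

end

theory Submission
  imports Defs "HOL-Library.Diagonal_Subsequence"
begin

text \<open>
  The proof is the direct method, applied to pairs of a tuple and a choice of its midpoints.

  Along a minimizing sequence the term \<open>\<sigma> E\<close> bounds all increments of the tuples, by coercivity of \<open>W\<close>.
  One entry is fixed by interpolation, so all entries are bounded, and then so are the midpoints,
  since \<open>F\<close> bounds the values of \<open>W\<close> between entries and midpoints (\<open>energy_sublevel_bounded\<close>).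
  Bounded sequences in a separable Hilbert space have weakly convergent subsequences (\<open>weakly_convergent_subseq\<close>), and the
  energy is weakly lower semicontinuous as a sum of weakly continuous terms and nonnegative
  quadratic forms (\<open>regularized_energy_weakly_lsc\<close>). The interpolation and boundary conditions are
  affine and involve finitely many entries, so they survive weak limits.

  The delicate point is that the constraint of being a midpoint also survives weak limits, although
  \<open>W\<close> is only lower semicontinuous (\<open>is_arg_min_weakly_closed\<close>). By the parallelogram law, with
  \<open>m = (a + b) / 2\<close>,
  \<open>Q (a - z) (a - z) + Q (z - b) (z - b) = Q (a - b) (a - b) / 2 + 2 Q (z - m) (z - m)\<close>,
  and the first summand is irrelevant for minimization in \<open>z\<close>. If \<open>m\<^sub>n\<close> converges weakly to \<open>m\<close>, the
  competitors \<open>z + (m\<^sub>n - m)\<close> converge weakly to \<open>z\<close> with constant second summand, so their reduced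
  energies converge, and minimality passes to the limit.
\<close>

section \<open>Weak convergence in Hilbert spaces\<close>

lemma weakly_converges_const: "weakly_converges (\<lambda>_. a) a"
  by (simp add: weakly_converges_def)

lemma weakly_converges_add:
  "weakly_converges x a \<Longrightarrow> weakly_converges y b \<Longrightarrow> weakly_converges (\<lambda>n. x n + y n) (a + b)"
  by (simp add: weakly_converges_def inner_add_left tendsto_add)

lemma weakly_converges_diff:
  "weakly_converges x a \<Longrightarrow> weakly_converges y b \<Longrightarrow> weakly_converges (\<lambda>n. x n - y n) (a - b)"
  by (simp add: weakly_converges_def inner_diff_left tendsto_diff)

lemma weakly_converges_scaleR:
  "weakly_converges x a \<Longrightarrow> weakly_converges (\<lambda>n. c *\<^sub>R x n) (c *\<^sub>R a)"
  by (simp add: weakly_converges_def tendsto_mult_left)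

lemma weakly_converges_subseq:
  "weakly_converges x a \<Longrightarrow> strict_mono r \<Longrightarrow> weakly_converges (\<lambda>n. x (r n)) a"
  unfolding weakly_converges_def using LIMSEQ_subseq_LIMSEQ[of _ _ r] by (fastforce simp: o_def)

lemma weakly_converges_unique:
  assumes "weakly_converges x a" "weakly_converges x b"
  shows "a = b"
proof -
  have "inner a w = inner b w" for w
    using assms LIMSEQ_unique unfolding weakly_converges_def by blast
  then show ?thesis
    by (metis vector_eq_rdot)
qed

text \<open>The representing vector minimizes the strictly convex functional
  \<open>J v = \<parallel>v\<parallel>\<^sup>2 - 2 f v\<close>: the parallelogram law makes every minimizing sequence a Cauchy sequence,
  and the Euler equation of the minimizer says that it represents \<open>f\<close>.\<close>

lemma riesz_representation:
  fixes f :: "'v::{real_inner, complete_space} \<Rightarrow> real"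
  assumes f: "bounded_linear f"
  obtains l where "\<And>w. f w = inner l w"
proof -
  have add: "\<And>v w. f (v + w) = f v + f w" and scaleR: "\<And>c v. f (c *\<^sub>R v) = c * f v"
    using f by (simp_all add: linear_simps)
  define J where "J v = (norm v)\<^sup>2 - 2 * f v" for v
  obtain B where B: "\<And>v. norm (f v) \<le> norm v * B"
    using bounded_linear.bounded[OF f] by blast
  have J_ge: "- B\<^sup>2 \<le> J v" for v
  proof -
    have "0 \<le> (norm v - B)\<^sup>2" by simp
    then show ?thesis
      using B[of v] unfolding J_def by (simp add: power2_diff mult.commute)
  qed
  define m where "m = Inf (range J)"
  have bdd: "bdd_below (range J)"
    using J_ge by (auto intro!: bdd_belowI2)
  have m_le: "m \<le> J v" for v
    unfolding m_def by (rule cInf_lower[OF _ bdd]) simp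
  have "\<exists>v. J v < m + inverse (real (Suc n))" for n
    using cInf_lessD[of "range J" "m + inverse (real (Suc n))"] by (auto simp: m_def)
  then obtain v where v: "\<And>n. J (v n) < m + inverse (real (Suc n))"
    by metis
  have parallelogram: "(norm (a - b))\<^sup>2 \<le> 2 * (J a - m) + 2 * (J b - m)" for a b
  proof -
    have "J ((1/2) *\<^sub>R (a + b)) = (J a + J b) / 2 - (norm (a - b))\<^sup>2 / 4"
      unfolding J_def scaleR add power2_norm_eq_inner
      by (simp add: inner_add_left inner_add_right inner_diff_left inner_diff_right
          inner_commute[of b a] field_simps)
    then show ?thesis
      using m_le[of "(1/2) *\<^sub>R (a + b)"] by (simp add: field_simps)
  qed
  have "Cauchy v"
  proof (rule metric_CauchyI)
    fix e :: real
    assume e: "0 < e"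
    obtain N where N: "inverse (real (Suc N)) < e\<^sup>2 / 4"
      using reals_Archimedean[of "e\<^sup>2 / 4"] e by auto
    have small: "4 * (J (v n) - m) < e\<^sup>2" if "N \<le> n" for n
    proof -
      have "inverse (real (Suc n)) \<le> inverse (real (Suc N))"
        using that by (simp add: field_simps)
      then show ?thesis
        using v[of n] N by argo
    qed
    have "dist (v i) (v j) < e" if "N \<le> i" "N \<le> j" for i j
    proof -
      have "(norm (v i - v j))\<^sup>2 < e\<^sup>2"
        using parallelogram[of "v i" "v j"] small[OF that(1)] small[OF that(2)] by argo
      then show ?thesis
        using e by (simp add: dist_norm power_less_imp_less_base)
    qed
    then show "\<exists>N. \<forall>i\<ge>N. \<forall>j\<ge>N. dist (v i) (v j) < e"
      by blast
  qed
  then obtain l where l: "v \<longlonglongrightarrow> l"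
    using Cauchy_convergent convergent_def by blast
  have "(\<lambda>n. J (v n)) \<longlonglongrightarrow> J l"
    unfolding J_def by (intro tendsto_intros bounded_linear.tendsto[OF f] l)
  moreover have "(\<lambda>n. m + inverse (real (Suc n))) \<longlonglongrightarrow> m"
    using tendsto_add[OF tendsto_const LIMSEQ_inverse_real_of_nat] by simp
  ultimately have Jl: "J l \<le> m"
    by (rule LIMSEQ_le) (use v in \<open>auto intro: less_imp_le\<close>)
  \<comment> \<open>The first variation of J at its minimizer vanishes.\<close>
  have "f w = inner l w" for w
  proof (rule ccontr)
    assume ne: "f w \<noteq> inner l w"
    define a where "a = inner l w - f w"
    have a: "a \<noteq> 0" and w: "norm w \<noteq> 0"
      using ne by (auto simp: a_def linear_simps[OF f])
    define s where "s = - a / (norm w)\<^sup>2"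
    have "J (l + s *\<^sub>R w) = J l + 2 * s * a + s\<^sup>2 * (norm w)\<^sup>2"
      unfolding J_def a_def scaleR add power2_norm_eq_inner
      by (simp add: inner_add_left inner_add_right inner_commute[of w l] power2_eq_square
          distrib_left distrib_right left_diff_distrib right_diff_distrib mult.assoc)
    also have "\<dots> = J l - a\<^sup>2 / (norm w)\<^sup>2"
      using w by (simp add: s_def field_simps power2_eq_square)
    also have "\<dots> < m"
    proof -
      have "0 < a\<^sup>2 / (norm w)\<^sup>2"
        using a w by (intro divide_pos_pos) auto
      then show ?thesis
        using Jl by linarith
    qed
    finally show False
      using m_le[of "l + s *\<^sub>R w"] by simp
  qed
  then show thesis
    using that by blast
qed

text \<open>Weak convergence is defined by testing against inner products; the Riesz representation extends
  the test to all bounded functionals, in particular to \<open>v \<mapsto> Q v x\<close>.\<close>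

lemma weakly_converges_bounded_linear:
  fixes f :: "'v::{real_inner, complete_space} \<Rightarrow> real"
  assumes "bounded_linear f" "weakly_converges x a"
  shows "(\<lambda>n. f (x n)) \<longlonglongrightarrow> f a"
proof -
  obtain l where "\<And>w. f w = inner l w"
    using riesz_representation[OF assms(1)] by blast
  then show ?thesis
    using assms(2) by (simp add: weakly_converges_def inner_commute[of l])
qed

text \<open>Bolzano--Weierstrass for the bounded real sequences \<open>inner (x n) d\<close>, one for each element \<open>d\<close> of a
  countable set, combined by a diagonal argument.\<close>

lemma inner_convergent_subseq:
  fixes x :: "nat \<Rightarrow> 'v::real_inner"
  assumes "countable D" "D \<noteq> {}" and B: "\<And>n. norm (x n) \<le> B"
  obtains r :: "nat \<Rightarrow> nat" where "strict_mono r" "\<And>d. d \<in> D \<Longrightarrow> convergent (\<lambda>n. inner (x (r n)) d)"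
proof -
  define d where "d = from_nat_into D"
  have D: "range d = D"
    using assms(1,2) by (simp add: d_def range_from_nat_into)
  interpret subseqs "\<lambda>k s. convergent (\<lambda>n. inner (x (s n)) (d k))"
  proof
    fix k and s :: "nat \<Rightarrow> nat"
    have "\<bar>inner (x (s n)) (d k)\<bar> \<le> B * norm (d k)" for n
      using Cauchy_Schwarz_ineq2[of "x (s n)" "d k"] mult_right_mono[OF B[of "s n"], of "norm (d k)"]
      by simp
    then have "bounded (range (\<lambda>n. inner (x (s n)) (d k)))"
      by (auto simp: bounded_iff)
    then obtain l r where "strict_mono r" "((\<lambda>n. inner (x (s n)) (d k)) \<circ> r) \<longlonglongrightarrow> l"
      using bounded_imp_convergent_subsequence by blast
    then show "\<exists>r. strict_mono r \<and> convergent (\<lambda>n. inner (x ((s \<circ> r) n)) (d k))"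
      by (auto simp: o_def convergent_def)
  qed
  have "convergent (\<lambda>n. inner (x (diagseq n)) (d k))" for k
  proof -
    have "convergent (\<lambda>n. inner (x ((diagseq \<circ> (+) (Suc k)) n)) (d k))"
    proof (rule diagseq_holds)
      fix r s :: "nat \<Rightarrow> nat" and n
      assume "strict_mono r" "convergent (\<lambda>j. inner (x (s j)) (d n))"
      then show "convergent (\<lambda>j. inner (x ((s \<circ> r) j)) (d n))"
        using convergent_subseq_convergent[of "\<lambda>j. inner (x (s j)) (d n)" r] by (simp add: o_def)
    qed
    then show ?thesis
      using convergent_ignore_initial_segment[of "\<lambda>n. inner (x (diagseq n)) (d k)" "Suc k"]
      by (simp add: o_def add.commute)
  qed
  then show thesis
    using that[OF subseq_diagseq] D by blast
qed

text \<open>Convergence of the inner products with the elements of a countable dense set extends to all test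
  vectors because the sequence is bounded. The limits depend linearly and boundedly on the test
  vector, so they are the inner products with a single vector, the weak limit.\<close>

lemma weakly_convergent_subseq:
  fixes x :: "nat \<Rightarrow> 'v::{real_inner, complete_space, second_countable_topology}"
  assumes B: "\<And>n. norm (x n) \<le> B"
  obtains r l where "strict_mono r" "weakly_converges (\<lambda>n. x (r n)) l"
proof -
  obtain D :: "'v set" where D: "countable D" "D \<noteq> {}"
    and dense: "\<And>U. open U \<Longrightarrow> U \<noteq> {} \<Longrightarrow> \<exists>d\<in>D. d \<in> U"
    using countable_dense_exists by blast
  obtain r where r: "strict_mono r" and conv: "\<And>d. d \<in> D \<Longrightarrow> convergent (\<lambda>n. inner (x (r n)) d)"
    using inner_convergent_subseq[of D x B] D B by metis
  have B0: "0 \<le> B"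
    using order_trans[OF norm_ge_zero B[of 0]] .
  have "convergent (\<lambda>n. inner (x (r n)) w)" for w
  proof (rule Cauchy_convergent, rule metric_CauchyI)
    fix e :: real
    assume e: "0 < e"
    \<comment> \<open>Replacing \<open>w\<close> by a point of \<open>D\<close> within \<open>\<delta>\<close> costs at most \<open>2 * B * \<delta>\<close>, less than \<open>e / 2\<close>;
      the summand 1 covers \<open>B = 0\<close>.\<close>
    define \<delta> where "\<delta> = e / (4 * (B + 1))"
    have \<delta>: "0 < \<delta>" "2 * B * \<delta> < e / 2"
    proof -
      show "0 < \<delta>"
        using e B0 by (simp add: \<delta>_def)
      then have "2 * B * \<delta> < 2 * \<delta> * (B + 1)"
        by (simp add: distrib_left)
      also have "\<dots> = e / 2"
        using B0 by (simp add: \<delta>_def divide_simps)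
      finally show "2 * B * \<delta> < e / 2" .
    qed
    obtain d where d: "d \<in> D" "dist w d < \<delta>"
      using dense[of "ball w \<delta>"] \<delta>(1) by auto
    have "Cauchy (\<lambda>n. inner (x (r n)) d)"
      using conv[OF d(1)] by (rule convergent_Cauchy)
    then obtain N where N: "\<And>i j. N \<le> i \<Longrightarrow> N \<le> j \<Longrightarrow>
        dist (inner (x (r i)) d) (inner (x (r j)) d) < e / 2"
      using e unfolding Cauchy_def by (meson half_gt_zero)
    have "dist (inner (x (r i)) w) (inner (x (r j)) w) < e" if "N \<le> i" "N \<le> j" for i j
    proof -
      have "\<bar>inner (x (r i) - x (r j)) (w - d)\<bar> \<le> norm (x (r i) - x (r j)) * norm (w - d)"
        by (rule Cauchy_Schwarz_ineq2)
      also have "\<dots> \<le> (2 * B) * \<delta>"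
        using norm_triangle_ineq4[of "x (r i)" "x (r j)"] B[of "r i"] B[of "r j"] d(2) B0
        by (intro mult_mono) (auto simp: dist_norm)
      finally have "\<bar>inner (x (r i) - x (r j)) (w - d)\<bar> < e / 2"
        using \<delta>(2) by simp
      then show ?thesis
        using N[OF that] unfolding dist_real_def inner_diff_left inner_diff_right by linarith
    qed
    then show "\<exists>N. \<forall>i\<ge>N. \<forall>j\<ge>N. dist (inner (x (r i)) w) (inner (x (r j)) w) < e"
      by blast
  qed
  then obtain f where f: "\<And>w. (\<lambda>n. inner (x (r n)) w) \<longlonglongrightarrow> f w"
    unfolding convergent_def by metis
  have "bounded_linear f"
  proof (rule bounded_linear_intro)
    show "f (v + w) = f v + f w" for v w
      using LIMSEQ_unique[OF f[of "v + w"]] tendsto_add[OF f[of v] f[of w]]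
      by (simp add: inner_add_right)
    show "f (c *\<^sub>R v) = c *\<^sub>R f v" for c v
      using LIMSEQ_unique[OF f[of "c *\<^sub>R v"]] tendsto_mult_left[OF f[of v], of c] by simp
    show "norm (f v) \<le> norm v * B" for v
    proof (rule LIMSEQ_le_const2[OF tendsto_norm[OF f]], intro exI allI impI)
      fix n
      show "norm (inner (x (r n)) v) \<le> norm v * B"
        using Cauchy_Schwarz_ineq2[of "x (r n)" v] mult_right_mono[OF B[of "r n"], of "norm v"]
        by (simp add: mult.commute)
    qed
  qed
  then obtain l where "\<And>w. f w = inner l w"
    using riesz_representation by blast
  then have "weakly_converges (\<lambda>n. x (r n)) l"
    using f by (simp add: weakly_converges_def)
  then show thesis
    using that r by blast
qed

lemma weakly_convergent_subseq_finite:
  fixes x :: "nat \<Rightarrow> 'i \<Rightarrow> 'v::{real_inner, complete_space, second_countable_topology}"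
  assumes "finite A" and B: "\<And>n i. i \<in> A \<Longrightarrow> norm (x n i) \<le> B"
  obtains r l where "strict_mono r" "\<And>i. i \<in> A \<Longrightarrow> weakly_converges (\<lambda>n. x (r n) i) (l i)"
proof -
  have "\<exists>r l. strict_mono r \<and> (\<forall>i\<in>A. weakly_converges (\<lambda>n. x (r n) i) (l i))"
    using assms
  proof (induction A)
    case empty
    show ?case
      using strict_mono_id by blast
  next
    case (insert a A)
    then have "\<exists>r l. strict_mono r \<and> (\<forall>i\<in>A. weakly_converges (\<lambda>n. x (r n) i) (l i))"
      by simp
    then obtain r l where r: "strict_mono r"
      and l: "\<And>i. i \<in> A \<Longrightarrow> weakly_converges (\<lambda>n. x (r n) i) (l i)"
      by blast
    obtain s m where s: "strict_mono s" and m: "weakly_converges (\<lambda>n. x (r (s n)) a) m"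
      using weakly_convergent_subseq[of "\<lambda>n. x (r n) a" B] insert.prems by auto
    have "weakly_converges (\<lambda>n. x ((r \<circ> s) n) i) ((l(a := m)) i)" if "i \<in> insert a A" for i
      using that m weakly_converges_subseq[OF l s] insert.hyps by auto
    then show ?case
      using strict_mono_o[OF r s] by blast
  qed
  then show thesis
    using that by blast
qed

section \<open>Lower semicontinuity and the direct method\<close>

text \<open>This is \<open>a \<le> liminf u\<close>, expressed by a minorant of \<open>u\<close> that converges to \<open>a\<close>. In this form the rules
  for sums and multiples follow from the limit laws of convergent sequences, and the lower
  semicontinuous functionals below come with an explicit minorant.\<close>

definition limit_below :: "ennreal \<Rightarrow> (nat \<Rightarrow> ennreal) \<Rightarrow> bool" where
  "limit_below a u \<longleftrightarrow> (\<exists>L. L \<longlonglongrightarrow> a \<and> (\<forall>n. L n \<le> u n))"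

lemma limit_belowI: "L \<longlonglongrightarrow> a \<Longrightarrow> (\<And>n. L n \<le> u n) \<Longrightarrow> limit_below a u"
  unfolding limit_below_def by blast

lemma limit_below_tendsto: "u \<longlonglongrightarrow> a \<Longrightarrow> limit_below a u"
  by (rule limit_belowI) auto

lemma limit_below_add:
  assumes "limit_below a u" "limit_below b v"
  shows "limit_below (a + b) (\<lambda>n. u n + v n)"
proof -
  obtain L M where "L \<longlonglongrightarrow> a" "\<And>n. L n \<le> u n" "M \<longlonglongrightarrow> b" "\<And>n. M n \<le> v n"
    using assms unfolding limit_below_def by blast
  then show ?thesis
    by (intro limit_belowI[of "\<lambda>n. L n + M n"] tendsto_add add_mono)
qed

lemma limit_below_sum:
  "(\<And>i. i \<in> A \<Longrightarrow> limit_below (a i) (u i)) \<Longrightarrow>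
    limit_below (\<Sum>i\<in>A. a i) (\<lambda>n. \<Sum>i\<in>A. u i n)"
  by (induction A rule: infinite_finite_induct)
    (simp_all add: limit_below_add limit_below_tendsto)

lemma limit_below_cmult:
  assumes "c < \<infinity>" "limit_below a u"
  shows "limit_below (c * a) (\<lambda>n. c * u n)"
proof -
  obtain L where "L \<longlonglongrightarrow> a" "\<And>n. L n \<le> u n"
    using assms(2) unfolding limit_below_def by blast
  then show ?thesis
    using assms(1)
    by (intro limit_belowI[of "\<lambda>n. c * L n"] ennreal_tendsto_cmult mult_left_mono) auto
qed

lemma limit_below_le:
  assumes "limit_below a u" "v \<longlonglongrightarrow> b" "\<And>n. u n \<le> v n"
  shows "a \<le> b"
proof -
  obtain L where "L \<longlonglongrightarrow> a" "\<And>n. L n \<le> u n"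
    using assms(1) unfolding limit_below_def by blast
  then show ?thesis
    using assms(2,3) by (intro LIMSEQ_le[of L a v b]) (blast intro: order_trans)+
qed

text \<open>The direct method of the calculus of variations. Compactness of sublevels, closedness of the
  constraint and lower semicontinuity of the functional are merged into one assumption on sequences,
  since weak convergence is given as a relation between sequences and limits, not by a topology.\<close>

lemma is_arg_min_exists_ennreal:
  fixes f :: "'a \<Rightarrow> ennreal"
  assumes x0: "P x0" "f x0 < \<infinity>"
    and compact: "\<And>x M. (\<And>n. P (x n)) \<Longrightarrow> (\<And>n. f (x n) \<le> M) \<Longrightarrow> M < \<infinity> \<Longrightarrow>
      \<exists>(r :: nat \<Rightarrow> nat) a. strict_mono r \<and> P a \<and> limit_below (f a) (\<lambda>n. f (x (r n)))"
  obtains a where "is_arg_min f P a"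
proof -
  define m where "m = Inf (f ` Collect P)"
  have m_le: "m \<le> f a" if "P a" for a
    unfolding m_def using that by (auto intro: Inf_lower)
  have m: "m < \<infinity>"
    using m_le[OF x0(1)] x0(2) by (rule le_less_trans)
  have "\<exists>x. P x \<and> f x \<le> m + ennreal (inverse (real (Suc n)))" for n
  proof -
    have "m < m + ennreal (inverse (real (Suc n)))"
      using ennreal_add_left_cancel_less[of m 0] m by (simp add: ennreal_less_zero_iff)
    then show ?thesis
      unfolding m_def Inf_less_iff by (auto intro: less_imp_le)
  qed
  then obtain x where x: "\<And>n. P (x n)" "\<And>n. f (x n) \<le> m + ennreal (inverse (real (Suc n)))"
    by metis
  have "f (x n) \<le> m + 1" for n
  proof -
    have "ennreal (inverse (real (Suc n))) \<le> ennreal 1"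
      by (rule ennreal_leI) (simp add: field_simps)
    then show ?thesis
      using x(2)[of n] add_left_mono order_trans by (metis ennreal_1)
  qed
  moreover have "m + 1 < \<infinity>"
    using m by simp
  ultimately obtain r a where r: "strict_mono (r :: nat \<Rightarrow> nat)" and a: "P a"
      "limit_below (f a) (\<lambda>n. f (x (r n)))"
    using compact[of x "m + 1"] x(1) by blast
  have "(\<lambda>n. m + ennreal (inverse (real (Suc n)))) \<longlonglongrightarrow> m + ennreal 0"
    by (intro tendsto_intros LIMSEQ_inverse_real_of_nat)
  from LIMSEQ_subseq_LIMSEQ[OF this r]
  have "(\<lambda>n. m + ennreal (inverse (real (Suc (r n))))) \<longlonglongrightarrow> m"
    by (simp add: o_def)
  with a(2) have "f a \<le> m"
    using x(2) by (rule limit_below_le)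
  then have "is_arg_min f P a"
    using a(1) m_le unfolding is_arg_min_def by (meson leD le_less_trans)
  then show thesis
    by (rule that)
qed

section \<open>Energies with a weakly continuous and a quadratic part\<close>

text \<open>The properties of an admissible energy on which existence rests: a weakly continuous part plus
  the square of a bounded seminorm, and boundedness of \<open>y - z\<close> on sublevels.\<close>

locale split_energy =
  fixes W Wc :: "'v::{real_inner, complete_space, second_countable_topology} \<Rightarrow> 'v \<Rightarrow> ennreal"
    and Q :: "'v \<Rightarrow> 'v \<Rightarrow> real"
  assumes W_split: "W y z = Wc y z + ennreal (Q (y - z) (y - z))"
    and Wc_finite: "Wc y z < \<infinity>"
    and Wc_weakly_continuous: "weakly_converges x a \<Longrightarrow> weakly_converges x' a' \<Longrightarrow>
      (\<lambda>n. Wc (x n) (x' n)) \<longlonglongrightarrow> Wc a a'"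
    and Q_bilinear: "bilinear Q"
    and Q_commute: "Q v w = Q w v"
    and Q_nonneg: "0 \<le> Q v v"
    and Q_le: "\<exists>C. \<forall>v. Q v v \<le> C * (norm v)\<^sup>2"
    and coercive: "M < \<infinity> \<Longrightarrow> \<exists>R. \<forall>y z. W y z \<le> M \<longrightarrow> norm (y - z) \<le> R"
begin

lemmas Q_expand =
  bilinear_ladd[OF Q_bilinear] bilinear_radd[OF Q_bilinear]
  bilinear_lsub[OF Q_bilinear] bilinear_rsub[OF Q_bilinear]
  bilinear_lmul[OF Q_bilinear] bilinear_rmul[OF Q_bilinear]

lemma W_finite: "W y z < \<infinity>"
  using Wc_finite[of y z] by (simp add: W_split)

text \<open>Polarization bounds \<open>Q u x\<close> for unit vectors \<open>u\<close> by the values of the quadratic form, and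
  homogeneity gives the bound in general.\<close>

lemma bounded_linear_Q: "bounded_linear (\<lambda>v. Q v x)"
proof -
  obtain C where C: "\<And>v. Q v v \<le> C * (norm v)\<^sup>2"
    using Q_le by blast
  have C_abs: "Q v v \<le> \<bar>C\<bar> * (norm v)\<^sup>2" for v
    by (rule order_trans[OF C]) (simp add: mult_right_mono)
  have unit: "\<bar>Q u x\<bar> \<le> \<bar>C\<bar> * (1 + norm x)\<^sup>2" if u: "norm u = 1" for u
  proof -
    have plus: "Q (u + x) (u + x) \<le> \<bar>C\<bar> * (1 + norm x)\<^sup>2"
      using C_abs[of "u + x"] norm_triangle_ineq[of u x] u
      by (intro order_trans[OF C_abs]) (auto intro!: mult_left_mono power_mono)
    have minus: "Q (u - x) (u - x) \<le> \<bar>C\<bar> * (1 + norm x)\<^sup>2"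
      using norm_triangle_ineq4[of u x] u
      by (intro order_trans[OF C_abs]) (auto intro!: mult_left_mono power_mono)
    have "4 * Q u x = Q (u + x) (u + x) - Q (u - x) (u - x)"
      by (simp add: Q_expand Q_commute[of x u])
    then show ?thesis
      using plus minus Q_nonneg[of "u + x"] Q_nonneg[of "u - x"] by linarith
  qed
  show ?thesis
  proof (rule bounded_linear_intro)
    show "norm (Q v x) \<le> norm v * (\<bar>C\<bar> * (1 + norm x)\<^sup>2)" for v
    proof (cases "v = 0")
      case True
      then show ?thesis
        by (simp add: bilinear_lzero[OF Q_bilinear])
    next
      case False
      have "Q v x = norm v * Q (sgn v) x"
        using False by (simp add: sgn_div_norm Q_expand)
      then show ?thesis
        using unit[of "sgn v"] False by (simp add: abs_mult norm_sgn mult_left_mono)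
    qed
  qed (simp_all add: Q_expand)
qed

text \<open>A convex quadratic form lies above its tangent \<open>v \<mapsto> 2 Q v a - Q a a\<close> at the weak limit \<open>a\<close>, because
  \<open>Q (v - a) (v - a)\<close> is nonnegative. The tangent is weakly continuous and touches the form at \<open>a\<close>.\<close>

lemma Q_weakly_lsc:
  assumes "weakly_converges x a"
  shows "limit_below (ennreal (Q a a)) (\<lambda>n. ennreal (Q (x n) (x n)))"
proof (rule limit_belowI)
  show "ennreal (2 * Q (x n) a - Q a a) \<le> ennreal (Q (x n) (x n))" for n
    using Q_nonneg[of "x n - a"] by (intro ennreal_leI) (simp add: Q_expand Q_commute[of a "x n"])
  have "(\<lambda>n. 2 * Q (x n) a - Q a a) \<longlonglongrightarrow> 2 * Q a a - Q a a"
    by (intro tendsto_intros weakly_converges_bounded_linear[OF bounded_linear_Q assms])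
  then show "(\<lambda>n. ennreal (2 * Q (x n) a - Q a a)) \<longlonglongrightarrow> ennreal (Q a a)"
    by (intro tendsto_ennrealI) simp
qed

lemma W_weakly_lsc:
  assumes "weakly_converges x a" "weakly_converges y b"
  shows "limit_below (W a b) (\<lambda>n. W (x n) (y n))"
  unfolding W_split
  using assms by (intro limit_below_add limit_below_tendsto Wc_weakly_continuous Q_weakly_lsc
      weakly_converges_diff)

text \<open>The energy \<open>W a z + W z b\<close> without the part of its quadratic terms that is independent of \<open>z\<close>: by the
  parallelogram law \<open>Q\<close> enters as \<open>Q (a - b) (a - b) / 2\<close> plus twice the form at the difference of
  \<open>z\<close> and the linear midpoint of \<open>a\<close> and \<open>b\<close>.\<close>

definition reduced :: "'v \<Rightarrow> 'v \<Rightarrow> 'v \<Rightarrow> ennreal" where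
  "reduced a b z = Wc a z + Wc z b +
     2 * ennreal (Q (z - (1/2) *\<^sub>R (a + b)) (z - (1/2) *\<^sub>R (a + b)))"

lemma W_sum_eq_reduced:
  "W a z + W z b = ennreal (Q (a - b) (a - b) / 2) + reduced a b z"
proof -
  define p where "p = z - (1/2) *\<^sub>R (a + b)"
  have "Q (a - z) (a - z) + Q (z - b) (z - b) = Q (a - b) (a - b) / 2 + 2 * Q p p"
    unfolding p_def
    by (simp add: Q_expand Q_commute[of b a] Q_commute[of z a] Q_commute[of z b] field_simps)
  then have "ennreal (Q (a - z) (a - z)) + ennreal (Q (z - b) (z - b)) =
      ennreal (Q (a - b) (a - b) / 2) + 2 * ennreal (Q p p)"
    using Q_nonneg by (simp add: ennreal_plus[symmetric] ennreal_mult'[symmetric]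
        flip: ennreal_numeral del: ennreal_plus)
  then show ?thesis
    unfolding W_split reduced_def p_def[symmetric] by (simp add: ac_simps)
qed

lemma is_arg_min_iff_reduced:
  "is_arg_min (\<lambda>z. W a z + W z b) (\<lambda>_. True) z \<longleftrightarrow> (\<forall>z'. reduced a b z \<le> reduced a b z')"
  unfolding is_arg_min_def W_sum_eq_reduced
  by (simp add: ennreal_add_left_cancel_less not_less)

text \<open>Along weakly converging end points the term \<open>Q (a - b) (a - b) / 2\<close> need not converge, but it does
  not affect the minimizers. For the reduced functional, a competitor \<open>z'\<close> of the limit problem is
  moved along with the linear midpoints of the end points. This keeps its quadratic term constant,
  so that its energy converges, while the energies of the minimizers are lower semicontinuous.\<close>

lemma is_arg_min_weakly_closed:
  assumes a: "weakly_converges x a" and b: "weakly_converges y b" and z: "weakly_converges u z"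
    and min: "\<And>n. is_arg_min (\<lambda>z. W (x n) z + W z (y n)) (\<lambda>_. True) (u n)"
  shows "is_arg_min (\<lambda>z. W a z + W z b) (\<lambda>_. True) z"
  unfolding is_arg_min_iff_reduced
proof
  fix z'
  define m where "m n = (1/2) *\<^sub>R (x n + y n)" for n
  define \<mu> where "\<mu> = (1/2) *\<^sub>R (a + b)"
  have m: "weakly_converges m \<mu>"
    unfolding m_def \<mu>_def by (intro weakly_converges_scaleR weakly_converges_add a b)
  have lsc: "limit_below (reduced a b z) (\<lambda>n. reduced (x n) (y n) (u n))"
    unfolding reduced_def m_def[symmetric] \<mu>_def[symmetric]
    by (intro limit_below_add limit_below_cmult limit_below_tendsto Wc_weakly_continuous
        Q_weakly_lsc weakly_converges_diff a b z m) simp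
  define w where "w n = z' + (m n - \<mu>)" for n
  have "weakly_converges w (z' + (\<mu> - \<mu>))"
    unfolding w_def
    by (intro weakly_converges_add weakly_converges_diff weakly_converges_const m)
  then have w: "weakly_converges w z'"
    by simp
  have "w n - m n = z' - \<mu>" for n
    by (simp add: w_def)
  then have "(\<lambda>n. reduced (x n) (y n) (w n)) \<longlonglongrightarrow> reduced a b z'"
    unfolding reduced_def m_def[symmetric] \<mu>_def[symmetric]
    by (simp only:) (intro tendsto_add Wc_weakly_continuous tendsto_const a b w)
  moreover have "reduced (x n) (y n) (u n) \<le> reduced (x n) (y n) (w n)" for n
    using min[of n] by (simp add: is_arg_min_iff_reduced)
  ultimately show "reduced a b z \<le> reduced a b z'"
    using limit_below_le[OF lsc] by blast
qed

text \<open>Without a discrete midpoint for every pair of end points there would be no admissible choice of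
  midpoints, and the set over which the spline energy is minimized could be empty.\<close>

lemma midpoint_exists: "\<exists>z. is_arg_min (\<lambda>z. W a z + W z b) (\<lambda>_. True) z"
proof (rule is_arg_min_exists_ennreal[where f = "\<lambda>z. W a z + W z b" and P = "\<lambda>_. True"])
  show "W a a + W a b < \<infinity>"
    using W_finite by simp
  fix x :: "nat \<Rightarrow> 'v" and M :: ennreal
  assume le: "\<And>n. W a (x n) + W (x n) b \<le> M" and M: "M < \<infinity>"
  obtain R where R: "\<And>y z. W y z \<le> M \<Longrightarrow> norm (y - z) \<le> R"
    using coercive[OF M] by blast
  have "norm (x n) \<le> norm a + R" for n
  proof -
    have "W a (x n) \<le> M"
      using le[of n] by (rule order_trans[rotated]) simp
    then show ?thesis
      using R norm_triangle_ineq2[of "x n" a] by (smt (verit) norm_minus_commute)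
  qed
  then obtain r l where "strict_mono r" and l: "weakly_converges (\<lambda>n. x (r n)) l"
    by (rule weakly_convergent_subseq)
  moreover have "limit_below (W a l + W l b) (\<lambda>n. W a (x (r n)) + W (x (r n)) b)"
    by (intro limit_below_add W_weakly_lsc weakly_converges_const l)
  ultimately show "\<exists>r l. strict_mono (r :: nat \<Rightarrow> nat) \<and> True \<and>
      limit_below (W a l + W l b) (\<lambda>n. W a (x (r n)) + W (x (r n)) b)"
    by blast
qed auto

end

section \<open>Discrete energies and constraints on tuples\<close>

text \<open>The metric supplies the bounds on \<open>Q\<close>. Since \<open>\<gamma>\<close> tends to infinity, a bound on \<open>W y z\<close> bounds
  \<open>norm (y - z)\<close>.\<close>

lemma split_energy_if_admissible:
  fixes \<iota> :: "'v::{real_inner, complete_space, second_countable_topology} \<Rightarrow> 'y::real_normed_vector"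
  assumes "admissible_metric \<iota> g gc Q" "admissible_W g Q W"
  obtains Wc where "split_energy W Wc Q"
proof -
  obtain Wc where Wc: "\<forall>y z. W y z = Wc y z + ennreal (Q (y - z) (y - z))"
      "\<forall>y z. Wc y z < \<infinity>"
      "\<forall>y z y' z'. weakly_converges y y' \<and> weakly_converges z z' \<longrightarrow>
        (\<lambda>n. Wc (y n) (z n)) \<longlonglongrightarrow> Wc y' z'"
    and ex_\<gamma>: "\<exists>\<gamma> :: real \<Rightarrow> real. strict_mono_on {0..} \<gamma> \<and> continuous_on {0..} \<gamma> \<and> \<gamma> 0 = 0 \<and>
      filterlim \<gamma> at_top at_top \<and> (\<forall>y z. ennreal (\<gamma> (norm (y - z))) \<le> W y z)"
    using assms(2) unfolding admissible_W_def by (elim exE conjE) (rule that, assumption+, blast)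
  obtain \<gamma> :: "real \<Rightarrow> real" where \<gamma>: "filterlim \<gamma> at_top at_top"
      "\<And>y z. ennreal (\<gamma> (norm (y - z))) \<le> W y z"
    using ex_\<gamma> by blast
  have coercive: "\<exists>R. \<forall>y z. W y z \<le> M \<longrightarrow> norm (y - z) \<le> R" if M: "M < \<infinity>" for M
  proof -
    obtain R where R: "\<And>d. R \<le> d \<Longrightarrow> enn2real M + 1 \<le> \<gamma> d"
      using \<gamma>(1) unfolding filterlim_at_top eventually_at_top_linorder by blast
    have "norm (y - z) \<le> R" if "W y z \<le> M" for y z
    proof (rule ccontr)
      assume "\<not> norm (y - z) \<le> R"
      then have "enn2real M < \<gamma> (norm (y - z))"
        using R[of "norm (y - z)"] by simp
      then have "ennreal (enn2real M) < ennreal (\<gamma> (norm (y - z)))"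
        by (simp add: ennreal_less_iff)
      then show False
        using M \<gamma>(2)[of y z] that by simp
    qed
    then show ?thesis
      by blast
  qed
  have "split_energy W Wc Q"
    using assms(1) Wc coercive unfolding admissible_metric_def by unfold_locales simp_all
  then show thesis
    by (rule that)
qed

lemma (in split_energy) midpoints_exist: "\<exists>yt. midpoints W bc K y yt"
  unfolding midpoints_def by (intro bchoice ballI midpoint_exists)

lemma K_hat_le: "K_hat bc K \<le> K"
  by (simp add: K_hat_def)

text \<open>In each boundary condition the successor is an entry of the tuple at an index that depends on \<open>k\<close>
  alone, so weak convergence of the entries carries over to it.\<close>

lemma successor_eq_entry:
  assumes "k \<in> {1..K_hat bc K}"
  obtains j where "j \<le> K" "\<And>y. successor bc K y k = y j"
proof (cases "bc = Periodic \<and> k = K")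
  case True
  then show thesis
    using assms that[of 1] by (simp add: successor_def)
next
  case False
  then have "k + 1 \<le> K"
    using assms by (auto simp: K_hat_def split: if_splits)
  then show thesis
    using False that[of "k + 1"] by (auto simp: successor_def)
qed

lemma (in split_energy) midpoints_weakly_closed:
  assumes K: "1 \<le> K"
    and y: "\<And>k. k \<le> K \<Longrightarrow> weakly_converges (\<lambda>n. Y n k) (y k)"
    and yt: "\<And>k. k \<in> {1..K_hat bc K} \<Longrightarrow> weakly_converges (\<lambda>n. Yt n k) (yt k)"
    and mid: "\<And>n. midpoints W bc K (Y n) (Yt n)"
  shows "midpoints W bc K y yt"
  unfolding midpoints_def
proof
  fix k
  assume k: "k \<in> {1..K_hat bc K}"
  obtain j where j: "j \<le> K" and succ: "\<And>y. successor bc K y k = y j" for y :: "nat \<Rightarrow> 'v"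
    using successor_eq_entry[OF k] by metis
  have "k - 1 \<le> K"
    using k K_hat_le[of bc K] by auto
  moreover have "is_arg_min (\<lambda>z. W (Y n (k - 1)) z + W z (Y n j)) (\<lambda>_. True) (Yt n k)" for n
    using bspec[OF mid[of n, unfolded midpoints_def] k] unfolding succ .
  ultimately show "is_arg_min (\<lambda>z. W (y (k - 1)) z + W z (successor bc K y k)) (\<lambda>_. True) (yt k)"
    unfolding succ using is_arg_min_weakly_closed y yt[OF k] j by blast
qed

lemma (in split_energy) regularized_energy_weakly_lsc:
  assumes y: "\<And>k. k \<le> K \<Longrightarrow> weakly_converges (\<lambda>n. Y n k) (y k)"
    and yt: "\<And>k. k \<in> {1..K_hat bc K} \<Longrightarrow> weakly_converges (\<lambda>n. Yt n k) (yt k)"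
  shows "limit_below (regularized_energy \<sigma> W bc K y yt)
    (\<lambda>n. regularized_energy \<sigma> W bc K (Y n) (Yt n))"
proof -
  have finite: "4 * of_nat K ^ 3 < (\<infinity>::ennreal)" "of_nat K < (\<infinity>::ennreal)"
      "ennreal \<sigma> < \<infinity>"
    by (simp_all add: ennreal_mult_less_top power_less_top_ennreal of_nat_less_top)
  have F: "limit_below (W (y k) (yt k)) (\<lambda>n. W (Y n k) (Yt n k))" if "k \<in> {1..K_hat bc K}" for k
    using that K_hat_le[of bc K] by (intro W_weakly_lsc y yt) auto
  have E: "limit_below (W (y (k - 1)) (y k)) (\<lambda>n. W (Y n (k - 1)) (Y n k))" if "k \<in> {1..K}" for k
    using that by (intro W_weakly_lsc y) auto
  show ?thesis
    unfolding regularized_energy_def F_energy_def E_energy_def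
    by (intro limit_below_add limit_below_cmult limit_below_sum finite F E)
qed

lemma (in split_energy) regularized_energy_finite: "regularized_energy \<sigma> W bc K y yt < \<infinity>"
proof -
  have "W a b < top" for a b
    using W_finite by simp
  then show ?thesis
    unfolding regularized_energy_def F_energy_def E_energy_def
    by (simp add: ennreal_mult_less_top power_less_top_ennreal of_nat_less_top)
qed

text \<open>The regularization \<open>\<sigma> > 0\<close> is what controls the increments of the tuple; the spline energy alone
  controls only the distances of its entries from their midpoints.\<close>

lemma regularized_energy_bounds:
  assumes "0 < \<sigma>" "1 \<le> K" and le: "regularized_energy \<sigma> W bc K y yt \<le> M"
  shows "k \<in> {1..K} \<Longrightarrow> W (y (k - 1)) (y k) \<le> ennreal (1 / \<sigma>) * M"
    and "k \<in> {1..K_hat bc K} \<Longrightarrow> W (y k) (yt k) \<le> M"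
proof -
  have K: "1 \<le> (of_nat K :: ennreal)"
    using assms(2) by (metis of_nat_1 of_nat_mono)
  show "W (y (k - 1)) (y k) \<le> ennreal (1 / \<sigma>) * M" if "k \<in> {1..K}"
  proof -
    have "W (y (k - 1)) (y k) \<le> (\<Sum>k=1..K. W (y (k - 1)) (y k))"
      using that by (intro member_le_sum) auto
    also have "\<dots> \<le> E_energy W K y"
      unfolding E_energy_def using mult_right_mono[OF K] by fastforce
    also have "\<dots> = ennreal (1 / \<sigma>) * (ennreal \<sigma> * E_energy W K y)"
      using assms(1) by (simp add: mult.assoc[symmetric] ennreal_mult'[symmetric])
    also have "\<dots> \<le> ennreal (1 / \<sigma>) * M"
      by (intro mult_left_mono order_trans[OF _ le]) (auto simp: regularized_energy_def)
    finally show ?thesis .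
  qed
  show "W (y k) (yt k) \<le> M" if "k \<in> {1..K_hat bc K}"
  proof -
    have "W (y k) (yt k) \<le> (\<Sum>k=1..K_hat bc K. W (y k) (yt k))"
      using that by (intro member_le_sum) auto
    also have "\<dots> \<le> F_energy W bc K y yt"
    proof -
      have "1 * 1 \<le> (4::ennreal) * of_nat K ^ 3"
        using K by (intro mult_mono one_le_power) auto
      from mult_right_mono[OF this] show ?thesis
        unfolding F_energy_def by fastforce
    qed
    also have "\<dots> \<le> M"
      by (rule order_trans[OF _ le]) (simp add: regularized_energy_def)
    finally show ?thesis .
  qed
qed

text \<open>Both entries are at distance at most \<open>K * R\<close> from \<open>y 0\<close>.\<close>

lemma norm_le_if_increments_le:
  fixes y :: "nat \<Rightarrow> 'v::real_normed_vector"
  assumes inc: "\<And>k. k \<in> {1..K} \<Longrightarrow> norm (y (k - 1) - y k) \<le> R"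
    and "0 \<le> R" "j \<le> K" "k \<le> K"
  shows "norm (y k) \<le> norm (y j) + 2 * real K * R"
proof -
  have dist0: "norm (y k - y 0) \<le> real k * R" if "k \<le> K" for k
    using that
  proof (induction k)
    case (Suc k)
    then show ?case
      using inc[of "Suc k"] norm_triangle_ineq[of "y (Suc k) - y k" "y k - y 0"]
      by (simp add: norm_minus_commute distrib_right)
  qed simp
  have "norm (y k - y 0) \<le> real K * R" "norm (y j - y 0) \<le> real K * R"
    using dist0[OF assms(3)] dist0[OF assms(4)] assms(2-4)
    by (auto elim!: order_trans intro!: mult_right_mono)
  then have "norm (y k - y j) \<le> 2 * real K * R"
    using norm_triangle_ineq4[of "y k - y 0" "y j - y 0"] by simp
  then show ?thesis
    using norm_triangle_ineq2[of "y k" "y j"] by linarith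
qed

lemma satisfies_bc_weakly_closed:
  fixes y :: "nat \<Rightarrow> 'v::real_inner"
  assumes K: "1 \<le> K"
    and y: "\<And>k. k \<le> K \<Longrightarrow> weakly_converges (\<lambda>n. Y n k) (y k)"
    and bc: "\<And>n. satisfies_bc bc K (Y n)"
  shows "satisfies_bc bc K y"
proof (cases bc)
  case (Hermite v0 v1)
  have diff: "real K *\<^sub>R (y i - y j) = v"
    if "i \<le> K" "j \<le> K" "\<And>n. real K *\<^sub>R (Y n i - Y n j) = v" for i j v
  proof (rule weakly_converges_unique)
    show "weakly_converges (\<lambda>n. real K *\<^sub>R (Y n i - Y n j)) (real K *\<^sub>R (y i - y j))"
      using that by (intro weakly_converges_scaleR weakly_converges_diff y)
    show "weakly_converges (\<lambda>n. real K *\<^sub>R (Y n i - Y n j)) v"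
      unfolding that by (rule weakly_converges_const)
  qed
  show ?thesis
    using bc K by (simp add: Hermite diff)
next
  case Periodic
  have "weakly_converges (\<lambda>n. Y n 0) (y K)"
    using y[of K] bc by (simp add: Periodic)
  then show ?thesis
    using y[of 0] by (simp add: Periodic weakly_converges_unique)
qed simp

lemma feasible_weakly_closed:
  fixes y :: "nat \<Rightarrow> 'v::real_inner"
  assumes K: "1 \<le> K" and t: "\<And>i. i \<in> {1..I} \<Longrightarrow> nat \<lfloor>real K * t i\<rfloor> \<le> K"
    and y: "\<And>k. k \<le> K \<Longrightarrow> weakly_converges (\<lambda>n. Y n k) (y k)"
    and feas: "\<And>n. feasible bc K I t ybar (Y n)"
  shows "feasible bc K I t ybar y"
proof -
  have "y (nat \<lfloor>real K * t i\<rfloor>) = ybar i" if "i \<in> {1..I}" for i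
  proof (rule weakly_converges_unique)
    show "weakly_converges (\<lambda>n. Y n (nat \<lfloor>real K * t i\<rfloor>)) (y (nat \<lfloor>real K * t i\<rfloor>))"
      using y t[OF that] by blast
    have "Y n (nat \<lfloor>real K * t i\<rfloor>) = ybar i" for n
      using feas that unfolding feasible_def interpolates_def by blast
    then show "weakly_converges (\<lambda>n. Y n (nat \<lfloor>real K * t i\<rfloor>)) (ybar i)"
      by (simp add: weakly_converges_const)
  qed
  moreover have "satisfies_bc bc K y"
    using K y by (rule satisfies_bc_weakly_closed[where Y = Y]) (use feas in \<open>simp_all add: feasible_def\<close>)
  ultimately show ?thesis
    unfolding feasible_def interpolates_def by blast
qed

text \<open>The interpolation times lie on the grid, at distinct indices in \<open>{0..K}\<close>, so taking the floor is
  exact and the interpolation conditions concern distinct entries of the tuple.\<close>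

lemma interpolation_index:
  fixes t :: "nat \<Rightarrow> real"
  assumes "1 \<le> K" "2 < I" "0 \<le> t 1" "strict_mono_on {1..I} t" "t I \<le> 1"
    and nat: "\<forall>i\<in>{1..I}. real K * t i \<in> \<nat>"
  shows "i \<in> {1..I} \<Longrightarrow> real (nat \<lfloor>real K * t i\<rfloor>) = real K * t i"
    and "i \<in> {1..I} \<Longrightarrow> nat \<lfloor>real K * t i\<rfloor> \<le> K"
    and "inj_on (\<lambda>i. nat \<lfloor>real K * t i\<rfloor>) {1..I}"
    and "i \<in> {1..I} \<Longrightarrow> t 1 \<le> t i" and "i \<in> {1..I} \<Longrightarrow> t i \<le> t I"
proof -
  have real: "real (nat \<lfloor>real K * t i\<rfloor>) = real K * t i" if "i \<in> {1..I}" for i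
    using nat that by (force elim!: Nats_cases)
  then show "i \<in> {1..I} \<Longrightarrow> real (nat \<lfloor>real K * t i\<rfloor>) = real K * t i" .
  have mono: "t i \<le> t j" if "i \<in> {1..I}" "j \<in> {1..I}" "i \<le> j" for i j
    using strict_mono_on_leD[OF assms(4) that] .
  show "i \<in> {1..I} \<Longrightarrow> t 1 \<le> t i" and le: "i \<in> {1..I} \<Longrightarrow> t i \<le> t I" for i
    using assms(2) mono[of 1 i] mono[of i I] by auto
  show "nat \<lfloor>real K * t i\<rfloor> \<le> K" if i: "i \<in> {1..I}"
  proof -
    have "real K * t i \<le> real K * 1"
      using le[OF i] assms(5) by (intro mult_left_mono) auto
    then show ?thesis
      using real[OF i] by linarith
  qed
  have "inj_on t {1..I}"
    using assms(4) by (rule strict_mono_on_imp_inj_on)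
  then show "inj_on (\<lambda>i. nat \<lfloor>real K * t i\<rfloor>) {1..I}"
  proof (intro inj_onI)
    fix i j
    assume inj: "inj_on t {1..I}" and ij: "i \<in> {1..I}" "j \<in> {1..I}"
      and "nat \<lfloor>real K * t i\<rfloor> = nat \<lfloor>real K * t j\<rfloor>"
    then have "real K * t i = real K * t j"
      using real by metis
    then have "t i = t j"
      using assms(1) by simp
    then show "i = j"
      using inj ij by (metis inj_onD)
  qed
qed

text \<open>Interpolation prescribes distinct entries and leaves the others free. In the periodic case one of
  the entries \<open>0\<close> and \<open>K\<close> is free by the compatibility of the times and is set equal to the other one.
  In the Hermite case the prescribed velocities may contradict the interpolation values at
  neighbouring grid points, whence the assumption.\<close>

lemma feasible_exists:
  fixes bc :: "'v::real_vector boundary_condition" and t :: "nat \<Rightarrow> real"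
  assumes t: "1 \<le> K" "2 < I" "0 \<le> t 1" "strict_mono_on {1..I} t" "t I \<le> 1"
      "\<forall>i\<in>{1..I}. real K * t i \<in> \<nat>"
    and bc: "times_compatible bc (t 1) (t I)"
      "\<forall>v0 v1. bc = Hermite v0 v1 \<longrightarrow> (\<exists>y. feasible bc K I t ybar y)"
  shows "\<exists>y. feasible bc K I t ybar y"
proof -
  note index = interpolation_index[OF t]
  define idx where "idx i = nat \<lfloor>real K * t i\<rfloor>" for i
  define y where "y = ybar \<circ> inv_into {1..I} idx"
  have inj: "inj_on idx {1..I}"
    using index(3) unfolding idx_def .
  have y: "y (idx i) = ybar i" if "i \<in> {1..I}" for i
    using inv_into_f_f[OF inj that] by (simp add: y_def)
  show ?thesis
  proof (cases bc)
    case Natural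
    then show ?thesis
      using y by (intro exI[of _ y]) (simp add: feasible_def interpolates_def idx_def)
  next
    case Hermite
    then show ?thesis
      using bc(2) by blast
  next
    case Periodic
    then consider "t 1 \<noteq> 0" | "t I \<noteq> 1"
      using bc(1) by auto
    then show ?thesis
    proof cases
      case 1
      have "idx i \<noteq> 0" if "i \<in> {1..I}" for i
      proof -
        have "0 < t i"
          using index(4)[OF that] t(3) 1 by linarith
        then have "0 < real K * t i"
          using t(1) by simp
        then show ?thesis
          using index(1)[OF that] by (auto simp: idx_def)
      qed
      then have "feasible bc K I t ybar (y(0 := y K))"
        using y t(1) by (auto simp: Periodic feasible_def interpolates_def idx_def)
      then show ?thesis by blast
    next
      case 2
      have "idx i \<noteq> K" if "i \<in> {1..I}" for i
      proof -
        have "t i < 1"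
          using index(5)[OF that] t(5) 2 by linarith
        then have "real K * t i < real K"
          using t(1) by simp
        then show ?thesis
          using index(1)[OF that] by (auto simp: idx_def)
      qed
      then have "feasible bc K I t ybar (y(K := y 0))"
        using y t(1) by (auto simp: Periodic feasible_def interpolates_def idx_def)
      then show ?thesis by blast
    qed
  qed
qed

text \<open>The increments of the tuple are bounded and one of its entries is fixed by interpolation, so all
  entries are bounded. The midpoints are bounded because the spline energy controls their distances
  from the entries.\<close>

lemma (in split_energy) energy_sublevel_bounded:
  assumes "0 < \<sigma>" "1 \<le> K" "j \<le> K" "M < \<infinity>"
  obtains B where
    "\<And>y yt k. regularized_energy \<sigma> W bc K y yt \<le> M \<Longrightarrow> y j = a \<Longrightarrow> k \<le> K \<Longrightarrow> norm (y k) \<le> B"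
    "\<And>y yt k. regularized_energy \<sigma> W bc K y yt \<le> M \<Longrightarrow> y j = a \<Longrightarrow> k \<in> {1..K_hat bc K} \<Longrightarrow>
      norm (yt k) \<le> B"
proof -
  have "ennreal (1 / \<sigma>) * M < \<infinity>"
    using assms(4) by (simp add: ennreal_mult_less_top)
  then obtain R0 where R0: "\<And>y z. W y z \<le> ennreal (1 / \<sigma>) * M \<Longrightarrow> norm (y - z) \<le> R0"
    using coercive by blast
  define R where "R = max R0 0"
  obtain S0 where S0: "\<And>y z. W y z \<le> M \<Longrightarrow> norm (y - z) \<le> S0"
    using coercive[OF assms(4)] by blast
  define S where "S = max S0 0"
  define B where "B = norm a + 2 * real K * R"
  have y: "norm (y k) \<le> B"
    if "regularized_energy \<sigma> W bc K y yt \<le> M" "y j = a" "k \<le> K" for y yt k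
  proof -
    have "norm (y (i - 1) - y i) \<le> R" if "i \<in> {1..K}" for i
      using R0[OF regularized_energy_bounds(1)[OF assms(1,2) \<open>regularized_energy _ _ _ _ _ _ \<le> M\<close> that]]
      by (simp add: R_def)
    then show ?thesis
      using norm_le_if_increments_le[of K y R j k] that assms(3) by (simp add: B_def R_def)
  qed
  have "norm (yt k) \<le> B + S"
    if le: "regularized_energy \<sigma> W bc K y yt \<le> M" and a: "y j = a" and k: "k \<in> {1..K_hat bc K}"
    for y yt k
  proof -
    have "norm (y k) \<le> B"
      using y[OF le a] k K_hat_le[of bc K] by auto
    moreover have "norm (y k - yt k) \<le> S"
      using S0[OF regularized_energy_bounds(2)[OF assms(1,2) le k]] by (simp add: S_def)
    ultimately show ?thesis
      using norm_triangle_ineq2[of "yt k" "y k"] norm_minus_commute[of "yt k" "y k"] by linarith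
  qed
  moreover have "B \<le> B + S"
    by (simp add: S_def)
  ultimately show thesis
    using that[of "B + S"] y order_trans by blast
qed

section \<open>Existence of discrete spline interpolations\<close>

theorem theorem3p10:
  fixes \<iota> :: "'v::{real_inner, complete_space, second_countable_topology} \<Rightarrow> 'y::banach"
    and g :: "'v \<Rightarrow> 'v \<Rightarrow> 'v \<Rightarrow> real"
    and gc :: "'y \<Rightarrow> 'y \<Rightarrow>\<^sub>L 'y \<Rightarrow>\<^sub>L real"
    and Q :: "'v \<Rightarrow> 'v \<Rightarrow> real"
    and W :: "'v \<Rightarrow> 'v \<Rightarrow> ennreal"
    and \<sigma> :: real
    and I K :: nat
    and t :: "nat \<Rightarrow> real"
    and ybar :: "nat \<Rightarrow> 'v"
    and bc :: "'v boundary_condition"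
  assumes "\<sigma> > 0"
    and "compact_embedding \<iota>"
    and "admissible_metric \<iota> g gc Q"
    and "admissible_W g Q W"
    and "I > 2"
    and "0 \<le> t 1" and "strict_mono_on {1..I} t" and "t I \<le> 1"
    and "K \<ge> 1" and "\<forall>i\<in>{1..I}. real K * t i \<in> \<nat>"
    and "times_compatible bc (t 1) (t I)"
    and "\<forall>v0 v1. bc = Hermite v0 v1 \<longrightarrow> (\<exists>y. feasible bc K I t ybar y)"
  shows "\<exists>y. discrete_spline_interpolation \<sigma> W bc K I t ybar y"
proof -
  obtain Wc where "split_energy W Wc Q"
    using split_energy_if_admissible[OF assms(3,4)] .
  then interpret split_energy W Wc Q .
  note index = interpolation_index[OF assms(9,5-8,10)]
  define j where "j = nat \<lfloor>real K * t 1\<rfloor>"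
  have one: "1 \<in> {1..I}"
    using assms(5) by simp
  have j: "j \<le> K" "\<And>y. feasible bc K I t ybar y \<Longrightarrow> y j = ybar 1"
    using index(2)[OF one] one unfolding j_def feasible_def interpolates_def by blast+
  let ?f = "\<lambda>(y, yt). regularized_energy \<sigma> W bc K y yt"
  let ?P = "\<lambda>(y, yt). feasible bc K I t ybar y \<and> midpoints W bc K y yt"
  obtain y0 where "feasible bc K I t ybar y0"
    using feasible_exists[OF assms(9,5-8,10-12)] by blast
  moreover obtain yt0 where "midpoints W bc K y0 yt0"
    using midpoints_exist by blast
  ultimately have start: "?P (y0, yt0)"
    by simp
  obtain p where "is_arg_min ?f ?P p"
  proof (rule is_arg_min_exists_ennreal[where f = ?f and P = ?P])
    show "?P (y0, yt0)"
      by (rule start)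
    show "?f (y0, yt0) < \<infinity>"
      using regularized_energy_finite by simp
    fix p :: "nat \<Rightarrow> (nat \<Rightarrow> 'v) \<times> (nat \<Rightarrow> 'v)" and M :: ennreal
    assume P: "\<And>n. ?P (p n)" and le: "\<And>n. ?f (p n) \<le> M" and M: "M < \<infinity>"
    define Y Yt where "Y = fst \<circ> p" and "Yt = snd \<circ> p"
    have p: "p n = (Y n, Yt n)" for n
      by (simp add: Y_def Yt_def)
    have feas: "\<And>n. feasible bc K I t ybar (Y n)" and mid: "\<And>n. midpoints W bc K (Y n) (Yt n)"
      and le: "\<And>n. regularized_energy \<sigma> W bc K (Y n) (Yt n) \<le> M"
      using P le by (simp_all add: p)
    obtain B where bounds:
      "\<And>y yt k. regularized_energy \<sigma> W bc K y yt \<le> M \<Longrightarrow> y j = ybar 1 \<Longrightarrow> k \<le> K \<Longrightarrow>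
        norm (y k) \<le> B"
      "\<And>y yt k. regularized_energy \<sigma> W bc K y yt \<le> M \<Longrightarrow> y j = ybar 1 \<Longrightarrow>
        k \<in> {1..K_hat bc K} \<Longrightarrow> norm (yt k) \<le> B"
      using energy_sublevel_bounded[OF assms(1,9) j(1) M, of bc "ybar 1"] by metis
    then have B: "\<And>n k. k \<in> {..K} \<Longrightarrow> norm (Y n k) \<le> B"
      "\<And>n k. k \<in> {1..K_hat bc K} \<Longrightarrow> norm (Yt n k) \<le> B"
      using bounds(1)[OF le j(2)[OF feas]] bounds(2)[OF le j(2)[OF feas]] by simp_all
    obtain r y where r: "strict_mono r"
      and y: "\<And>k. k \<in> {..K} \<Longrightarrow> weakly_converges (\<lambda>n. Y (r n) k) (y k)"
      using weakly_convergent_subseq_finite[of "{..K}" Y B] B(1) by blast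
    obtain s yt where s: "strict_mono s"
      and yt: "\<And>k. k \<in> {1..K_hat bc K} \<Longrightarrow> weakly_converges (\<lambda>n. Yt (r (s n)) k) (yt k)"
      using weakly_convergent_subseq_finite[of "{1..K_hat bc K}" "\<lambda>n. Yt (r n)" B] B(2) by blast
    have y': "weakly_converges (\<lambda>n. Y (r (s n)) k) (y k)" if "k \<le> K" for k
      using weakly_converges_subseq[OF y s] that by simp
    have "feasible bc K I t ybar y"
      using feasible_weakly_closed[OF assms(9) index(2) y' feas] .
    moreover have "midpoints W bc K y yt"
      using midpoints_weakly_closed[OF assms(9) y' yt mid] .
    moreover have "limit_below (?f (y, yt)) (\<lambda>n. ?f (p ((r \<circ> s) n)))"
      using regularized_energy_weakly_lsc[OF y' yt] by (simp add: p)
    ultimately show "\<exists>(r :: nat \<Rightarrow> nat) q. strict_mono r \<and> ?P q \<and>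
        limit_below (?f q) (\<lambda>n. ?f (p (r n)))"
      using strict_mono_o[OF r s] by (intro exI[of _ "r \<circ> s"] exI[of _ "(y, yt)"]) simp
  qed
  then show ?thesis
    unfolding discrete_spline_interpolation_def by (cases p) blast
qed

end
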